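(* Let $\phi=\frac{1+\sqrt5}{2}$. For the problem of scheduling with uncertain processing times on a single machine with the objective of minimizing the total completion time, the algorithm $(\alpha,\beta)$-PCP with $\alpha=\phi$ and $\beta=\frac{\phi+\sqrt{5\phi+1}}{2}$ has competitive ratio at most $\frac{\phi+\sqrt{5\phi+1}}{2}\le 2.316513$. Moreover, this choice of $\alpha$ and $\beta$ is optimal for the expression $$\max\left\{\alpha\left(1+\tfrac1\beta\right),\ 1+\tfrac1\alpha+\tfrac1\beta+\tfrac1{\alpha\beta},\ \beta,\ 2,\ 1+\tfrac2\alpha\right\},$$ i.e. it minimizes this expression over all choices of the parameters $\alpha,\beta\ge1$.
   Context: Problem. There are $n$ jobs, all available at time $0$. Job $j$ has a testing time $t_j\ge 0$, an upper limit $u_j\ge 0$, and a real processing time $p_j\in[0,u_j]$. A job may be executed untested, which takes $u_j$ time units, or it may be tested (taking $t_j$ time units) and later executed in $p_j$ time units; other tasks may run between the test and the execution. A single machine runs one task at a time. The completion time of a job is the time at which its execution (or execution-untested) ends, and the cost of a schedule is the sum of the completion times of all jobs. An online algorithm knows all $t_j,u_j$ from the start, but learns $p_j$ only when the test of $j$ is finished. $\mathrm{OPT}$ knows all $p_j$ in advance (but must still test $j$ in order to run it in time $p_j$), and its cost is the minimum cost of any schedule. The competitive ratio of an online algorithm $A$ is the smallest $c$ such that $\mathrm{cost}(A)\le c\cdot \mathrm{cost}(\mathrm{OPT})$ on all instances. Algorithm $(\alpha,\beta)$-PCP (Prioritizing-Certain-Processing-time). Maintain a priority queue of tasks, smaller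 weight meaning higher priority (ties broken arbitrarily). Initially, for each job $j$: if $u_j\ge\alpha t_j$, insert a testing task of weight $\beta t_j$; otherwise insert an execution-untested task of weight $u_j$. While the queue is nonempty, extract a task of smallest weight and run it; if it was the testing task of job $j$, then after the test insert an execution task for $j$ with weight $t_j+p_j$ (running this execution task takes $p_j$ time). *)

theory Defs
  imports Complex_Main "HOL-Library.Extended_Real"
begin

section \<open>Instances, schedules and the offline optimum\<close>

text \<open>The jobs of an instance are the numbers below \<open>jobs\<close>; only the values of the other fields on
  these numbers matter.\<close>

record inst =
  jobs :: nat
  ttime :: "nat \<Rightarrow> real"
  upper :: "nat \<Rightarrow> real"
  ptime :: "nat \<Rightarrow> real"

definition valid_inst :: "inst \<Rightarrow> bool" where
  "valid_inst I \<longleftrightarrow>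
     (\<forall>j<jobs I. 0 \<le> ttime I j \<and> 0 \<le> upper I j \<and> 0 \<le> ptime I j \<and> ptime I j \<le> upper I j)"

datatype task = Test nat | Exec nat | Untested nat

fun duration :: "inst \<Rightarrow> task \<Rightarrow> real" where
  "duration I (Test j) = ttime I j"
| "duration I (Exec j) = ptime I j"
| "duration I (Untested j) = upper I j"

text \<open>A schedule maps the tasks that it runs to their starting times. Idle time is allowed,
  preemption is not.\<close>

type_synonym schedule = "task \<rightharpoonup> real"

definition start :: "schedule \<Rightarrow> task \<Rightarrow> real" where
  "start S x = the (S x)"

definition finish :: "inst \<Rightarrow> schedule \<Rightarrow> task \<Rightarrow> real" where
  "finish I S x = start S x + duration I x"

text \<open>The tasks to be run if \<open>D\<close> is the set of jobs that are tested.\<close>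

definition task_set :: "inst \<Rightarrow> nat set \<Rightarrow> task set" where
  "task_set I D = (\<Union>j<jobs I. if j \<in> D then {Test j, Exec j} else {Untested j})"

definition feasible :: "inst \<Rightarrow> schedule \<Rightarrow> bool" where
  "feasible I S \<longleftrightarrow>
     (\<exists>D. dom S = task_set I D) \<and>
     (\<forall>x\<in>dom S. 0 \<le> start S x) \<and>
     (\<forall>x\<in>dom S. \<forall>y\<in>dom S. x \<noteq> y \<longrightarrow> finish I S x \<le> start S y \<or> finish I S y \<le> start S x) \<and>
     (\<forall>j. Test j \<in> dom S \<longrightarrow> finish I S (Test j) \<le> start S (Exec j))"

definition completion :: "inst \<Rightarrow> schedule \<Rightarrow> nat \<Rightarrow> real" where
  "completion I S j = finish I S (if Untested j \<in> dom S then Untested j else Exec j)"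

definition cost :: "inst \<Rightarrow> schedule \<Rightarrow> real" where
  "cost I S = (\<Sum>j<jobs I. completion I S j)"

text \<open>For a valid instance the infimum is a minimum: there are finitely many choices of \<open>D\<close> and of
  the order of the tasks, and running the tasks without idle time is best for each of them.\<close>

definition opt_cost :: "inst \<Rightarrow> real" where
  "opt_cost I = Inf {cost I S |S. feasible I S}"


section \<open>Competitive ratio\<close>

text \<open>An algorithm is given by the set of its possible outcomes on each instance, so that ties may
  be broken arbitrarily; the ratio bounds every outcome. The ratio is extended-real valued, so that
  it is \<open>\<infinity>\<close> if there is no admissible constant.\<close>

definition competitive :: "(inst \<Rightarrow> schedule set) \<Rightarrow> real \<Rightarrow> bool" where
  "competitive A c \<longleftrightarrow> (\<forall>I. valid_inst I \<longrightarrow> (\<forall>S\<in>A I. cost I S \<le> c * opt_cost I))"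

definition competitive_ratio :: "(inst \<Rightarrow> schedule set) \<Rightarrow> ereal" where
  "competitive_ratio A = Inf {ereal c |c. competitive A c}"


section \<open>The algorithm PCP\<close>

definition pcp_init :: "real \<Rightarrow> inst \<Rightarrow> task set" where
  "pcp_init \<alpha> I = {if upper I j \<ge> \<alpha> * ttime I j then Test j else Untested j |j. j < jobs I}"

fun weight :: "real \<Rightarrow> inst \<Rightarrow> task \<Rightarrow> real" where
  "weight \<beta> I (Test j) = \<beta> * ttime I j"
| "weight \<beta> I (Exec j) = ttime I j + ptime I j"
| "weight \<beta> I (Untested j) = upper I j"

fun successors :: "task \<Rightarrow> task set" where
  "successors (Test j) = {Exec j}"
| "successors (Exec j) = {}"
| "successors (Untested j) = {}"

text \<open>A state consists of the queue, the current time and the schedule so far. Processing times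
  of untested jobs influence neither the tasks in the queue nor their weights: \<open>Exec j\<close> enters the
  queue only after \<open>Test j\<close> has been run.\<close>

inductive pcp_step ::
  "real \<Rightarrow> inst \<Rightarrow> task set \<times> real \<times> schedule \<Rightarrow> task set \<times> real \<times> schedule \<Rightarrow> bool"
  for \<beta> :: real and I :: inst where
  "x \<in> Q \<Longrightarrow> (\<forall>y\<in>Q. weight \<beta> I x \<le> weight \<beta> I y) \<Longrightarrow>
     pcp_step \<beta> I (Q, T, S) (Q - {x} \<union> successors x, T + duration I x, S(x \<mapsto> T))"

definition pcp :: "real \<Rightarrow> real \<Rightarrow> inst \<Rightarrow> schedule set" where
  "pcp \<alpha> \<beta> I =
     {S. \<exists>T. (pcp_step \<beta> I)\<^sup>*\<^sup>* (pcp_init \<alpha> I, 0, Map.empty) ({}, T, S)}"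


section \<open>Basic properties\<close>

definition tested_jobs :: "real \<Rightarrow> inst \<Rightarrow> nat set" where
  "tested_jobs \<alpha> I = {j. upper I j \<ge> \<alpha> * ttime I j}"

definition pcp_inv :: "real \<Rightarrow> inst \<Rightarrow> task set \<times> real \<times> schedule \<Rightarrow> bool" where
  "pcp_inv \<alpha> I = (\<lambda>(Q, T, S).
     dom S \<subseteq> task_set I (tested_jobs \<alpha> I) \<and>
     Q = {x \<in> task_set I (tested_jobs \<alpha> I) - dom S. \<forall>j. x = Exec j \<longrightarrow> Test j \<in> dom S} \<and>
     0 \<le> T \<and>
     (\<forall>x\<in>dom S. 0 \<le> start S x \<and> finish I S x \<le> T) \<and>
     (\<forall>x\<in>dom S. \<forall>y\<in>dom S. x \<noteq> y \<longrightarrow> finish I S x \<le> start S y \<or> finish I S y \<le> start S x) \<and>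
     (\<forall>j. Exec j \<in> dom S \<longrightarrow> Test j \<in> dom S \<and> finish I S (Test j) \<le> start S (Exec j)))"

lemma finite_task_set: "finite (task_set I D)"
  unfolding task_set_def by auto

lemma task_set_iff:
  "Test j \<in> task_set I D \<longleftrightarrow> j < jobs I \<and> j \<in> D"
  "Exec j \<in> task_set I D \<longleftrightarrow> j < jobs I \<and> j \<in> D"
  "Untested j \<in> task_set I D \<longleftrightarrow> j < jobs I \<and> j \<notin> D"
  unfolding task_set_def by (auto split: if_splits)

lemma duration_nonneg: "valid_inst I \<Longrightarrow> x \<in> task_set I D \<Longrightarrow> 0 \<le> duration I x"
  by (cases x) (auto simp: valid_inst_def task_set_iff)

lemma pcp_inv_init: "pcp_inv \<alpha> I (pcp_init \<alpha> I, 0, Map.empty)"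
proof -
  have "x \<in> pcp_init \<alpha> I \<longleftrightarrow>
      x \<in> task_set I (tested_jobs \<alpha> I) \<and> (\<forall>j. x \<noteq> Exec j)" for x
    by (cases x) (auto simp: pcp_init_def task_set_iff tested_jobs_def)
  then show ?thesis unfolding pcp_inv_def by auto
qed

lemma pcp_inv_step:
  assumes "valid_inst I" "pcp_step \<beta> I s s'" "pcp_inv \<alpha> I s"
  shows "pcp_inv \<alpha> I s'"
  using assms(2)
proof cases
  case (1 x Q T S)
  let ?U = "task_set I (tested_jobs \<alpha> I)"
  let ?S = "S(x \<mapsto> T)"
  let ?T = "T + duration I x"
  have inv: "dom S \<subseteq> ?U" "Q = {x \<in> ?U - dom S. \<forall>j. x = Exec j \<longrightarrow> Test j \<in> dom S}" "0 \<le> T"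
    "\<And>x. x \<in> dom S \<Longrightarrow> 0 \<le> start S x \<and> finish I S x \<le> T"
    "\<And>x y. x \<in> dom S \<Longrightarrow> y \<in> dom S \<Longrightarrow> x \<noteq> y \<Longrightarrow>
       finish I S x \<le> start S y \<or> finish I S y \<le> start S x"
    "\<And>j. Exec j \<in> dom S \<Longrightarrow> Test j \<in> dom S \<and> finish I S (Test j) \<le> start S (Exec j)"
    using assms(3) unfolding 1(1) pcp_inv_def by (simp_all only: prod.case) blast+
  have x: "x \<in> ?U" "x \<notin> dom S" "\<And>j. x = Exec j \<Longrightarrow> Test j \<in> dom S"
    using 1(3) inv(2) by auto
  have d: "0 \<le> duration I x" using duration_nonneg assms(1) x(1) by blast
  have new: "start ?S x = T" "finish I ?S x = ?T" by (auto simp: start_def finish_def)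
  have old: "start ?S y = start S y" "finish I ?S y = finish I S y" if "y \<in> dom S" for y
    using that x(2) by (auto simp: start_def finish_def)
  have dom: "dom ?S = insert x (dom S)" by simp
  have queue: "Q - {x} \<union> successors x =
      {y \<in> ?U - dom ?S. \<forall>j. y = Exec j \<longrightarrow> Test j \<in> dom ?S}"
  proof (cases x)
    case (Test j)
    have "Exec j \<notin> dom S" using inv(6) x(2) Test by blast
    moreover have "Exec j \<in> ?U" using x(1) Test by (simp add: task_set_iff)
    ultimately show ?thesis unfolding dom using inv(2) Test by auto
  qed (unfold dom, use inv(2) in auto)
  have "\<forall>y\<in>dom ?S. 0 \<le> start ?S y \<and> finish I ?S y \<le> ?T"
    unfolding dom using inv(3,4) d new old by fastforce
  moreover have "\<forall>y\<in>dom ?S. \<forall>z\<in>dom ?S. y \<noteq> z \<longrightarrow>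
      finish I ?S y \<le> start ?S z \<or> finish I ?S z \<le> start ?S y"
    unfolding dom using inv(4,5) new old by (metis insertE)
  moreover have "\<forall>j. Exec j \<in> dom ?S \<longrightarrow>
      Test j \<in> dom ?S \<and> finish I ?S (Test j) \<le> start ?S (Exec j)"
    unfolding dom using inv(4,6) x(3) new old by (metis insert_iff)
  ultimately show ?thesis
    unfolding 1(2) pcp_inv_def prod.case using queue inv(1,3) d x(1) dom by simp
qed

lemma pcp_inv_steps:
  assumes "valid_inst I" "(pcp_step \<beta> I)\<^sup>*\<^sup>* s s'" "pcp_inv \<alpha> I s"
  shows "pcp_inv \<alpha> I s'"
  using assms(2,3) by induction (auto intro: pcp_inv_step[OF assms(1)])

lemma pcp_inv_final:
  assumes "pcp_inv \<alpha> I ({}, T, S)"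
  shows "dom S = task_set I (tested_jobs \<alpha> I)"
proof -
  let ?U = "task_set I (tested_jobs \<alpha> I)"
  have sub: "dom S \<subseteq> ?U"
    and emp: "{} = {x \<in> ?U - dom S. \<forall>j. x = Exec j \<longrightarrow> Test j \<in> dom S}"
    using assms unfolding pcp_inv_def by auto
  have "x \<in> dom S" if "x \<in> ?U" for x
  proof (cases x)
    case (Exec j)
    have "Test j \<in> ?U" using that Exec by (simp add: task_set_iff)
    then have "Test j \<in> dom S" using emp by auto
    then show ?thesis using that emp Exec by blast
  qed (use that emp in blast)+
  then show ?thesis using sub by blast
qed

theorem pcp_feasible:
  assumes "valid_inst I" "S \<in> pcp \<alpha> \<beta> I"
  shows "feasible I S"
proof -
  obtain T where T: "pcp_inv \<alpha> I ({}, T, S)"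
    using assms pcp_inv_steps[OF assms(1) _ pcp_inv_init] unfolding pcp_def by blast
  have dom: "dom S = task_set I (tested_jobs \<alpha> I)" by (rule pcp_inv_final[OF T])
  have "finish I S (Test j) \<le> start S (Exec j)" if "Test j \<in> dom S" for j
  proof -
    have "Exec j \<in> dom S" using that unfolding dom by (simp add: task_set_iff)
    then show ?thesis using T unfolding pcp_inv_def by blast
  qed
  then show ?thesis using dom T unfolding feasible_def pcp_inv_def by blast
qed

lemma pcp_terminates:
  assumes "valid_inst I" "pcp_inv \<alpha> I (Q, T, S)"
  shows "\<exists>T' S'. (pcp_step \<beta> I)\<^sup>*\<^sup>* (Q, T, S) ({}, T', S')"
  using assms(2)
proof (induction "card (task_set I (tested_jobs \<alpha> I) - dom S)" arbitrary: Q T S rule: less_induct)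
  case less
  let ?U = "task_set I (tested_jobs \<alpha> I)"
  have Q: "Q \<subseteq> ?U - dom S" using less.prems unfolding pcp_inv_def by auto
  then have fin: "finite Q" using finite_task_set finite_subset by blast
  show ?case
  proof (cases "Q = {}")
    case False
    define x where "x = arg_min_on (weight \<beta> I) Q"
    have x: "x \<in> Q" "\<forall>y\<in>Q. weight \<beta> I x \<le> weight \<beta> I y"
      unfolding x_def using arg_min_if_finite(1)[OF fin False] arg_min_least[OF fin False] by auto
    let ?s = "(Q - {x} \<union> successors x, T + duration I x, S(x \<mapsto> T))"
    have step: "pcp_step \<beta> I (Q, T, S) ?s" using x by (rule pcp_step.intros)
    have "card (?U - dom (S(x \<mapsto> T))) < card (?U - dom S)"
      using x(1) Q by (intro psubset_card_mono) (auto simp: finite_task_set)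
    from less.hyps[OF this pcp_inv_step[OF assms(1) step less.prems]] obtain T' S'
      where "(pcp_step \<beta> I)\<^sup>*\<^sup>* ?s ({}, T', S')" by blast
    with step show ?thesis by (meson converse_rtranclp_into_rtranclp)
  qed auto
qed

theorem pcp_nonempty: "valid_inst I \<Longrightarrow> pcp \<alpha> \<beta> I \<noteq> {}"
  using pcp_terminates[OF _ pcp_inv_init] unfolding pcp_def by blast

lemma cost_nonneg:
  assumes "valid_inst I" "feasible I S"
  shows "0 \<le> cost I S"
  unfolding cost_def
proof (rule sum_nonneg)
  fix j assume "j \<in> {..<jobs I}"
  then have j: "j < jobs I" by simp
  obtain D where D: "dom S = task_set I D" using assms(2) unfolding feasible_def by blast
  let ?x = "if Untested j \<in> dom S then Untested j else Exec j"
  have x: "?x \<in> dom S" using j unfolding D by (simp add: task_set_iff)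
  then have "0 \<le> start S ?x" using assms(2) unfolding feasible_def by blast
  moreover have "0 \<le> duration I ?x" using duration_nonneg[OF assms(1)] x unfolding D by blast
  ultimately show "0 \<le> completion I S j" unfolding completion_def finish_def by linarith
qed

lemma opt_cost_le:
  assumes "valid_inst I" "feasible I S"
  shows "opt_cost I \<le> cost I S"
  unfolding opt_cost_def
  by (rule cInf_lower) (use assms cost_nonneg[OF assms(1)] in \<open>auto intro!: bdd_belowI[of _ 0]\<close>)

lemma opt_cost_greatest:
  assumes "valid_inst I" "\<And>S. feasible I S \<Longrightarrow> c \<le> cost I S"
  shows "c \<le> opt_cost I"
  unfolding opt_cost_def
proof (rule cInf_greatest)
  show "{cost I S |S. feasible I S} \<noteq> {}"
    using pcp_nonempty[OF assms(1)] pcp_feasible[OF assms(1)] by fastforce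
qed (use assms(2) in auto)

lemma opt_cost_nonneg: "valid_inst I \<Longrightarrow> 0 \<le> opt_cost I"
  by (rule opt_cost_greatest) (auto intro: cost_nonneg)

theorem competitive_ratio_le_iff: "competitive_ratio A \<le> ereal c \<longleftrightarrow> competitive A c"
proof
  assume "competitive A c"
  then show "competitive_ratio A \<le> ereal c"
    unfolding competitive_ratio_def by (auto intro: Inf_lower)
next
  assume le: "competitive_ratio A \<le> ereal c"
  show "competitive A c"
    unfolding competitive_def
  proof (intro allI impI ballI)
    fix I S assume I: "valid_inst I" and S: "S \<in> A I"
    have *: "cost I S \<le> b * opt_cost I" if "c < b" for b
    proof -
      have "competitive_ratio A < ereal b"
        using le that by (meson less_ereal.simps(1) order_le_less_trans)
      then obtain c' where c': "competitive A c'" "c' < b"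
        unfolding competitive_ratio_def by (auto simp: Inf_less_iff)
      have "cost I S \<le> c' * opt_cost I" using c'(1) I S unfolding competitive_def by blast
      also have "\<dots> \<le> b * opt_cost I"
        using c'(2) opt_cost_nonneg[OF I] by (intro mult_right_mono) auto
      finally show ?thesis .
    qed
    have "((\<lambda>b. b * opt_cost I) \<longlongrightarrow> c * opt_cost I) (at_right c)"
      by (intro tendsto_intros)
    moreover have "eventually (\<lambda>b. cost I S \<le> b * opt_cost I) (at_right c)"
      using * by (auto simp: eventually_at_filter)
    ultimately show "cost I S \<le> c * opt_cost I"
      by (intro tendsto_lowerbound[where F = "at_right c"]) auto
  qed
qed

end

theory Submission
  imports Defs
begin

text \<open>Let \<open>q\<^sub>j = min u\<^sub>j (t\<^sub>j + p\<^sub>j)\<close>. For two jobs \<open>j\<close> and \<open>k\<close>, the job that is completed first delays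
  the other one by at least \<open>min q\<^sub>j q\<^sub>k\<close> in every schedule. In a PCP schedule, the time spent on \<open>j\<close>
  before the completion of \<open>k\<close> plus the time spent on \<open>k\<close> before the completion of \<open>j\<close> is at most
  \<open>\<rho> * min q\<^sub>j q\<^sub>k\<close>, where \<open>\<rho>\<close> is the maximum of the five expressions: for every order of the tasks of
  the two jobs this follows from the weights of the tasks that were in the queue together. Summing
  over all pairs yields the ratio. The parameters \<open>\<phi>\<close> and \<open>\<beta>\<^sub>0\<close> solve \<open>1 + 1 / \<alpha> = \<alpha>\<close> and
  \<open>\<alpha> * (1 + 1 / \<beta>) = \<beta>\<close>, so that the first three expressions coincide.\<close>

section \<open>A lower bound for every schedule\<close>

definition opt_time :: "inst \<Rightarrow> nat \<Rightarrow> real" where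
  "opt_time I j = min (upper I j) (ttime I j + ptime I j)"

text \<open>The diagonal is doubled because the sum over all ordered pairs counts everything twice.\<close>

definition pair_opt :: "inst \<Rightarrow> nat \<Rightarrow> nat \<Rightarrow> real" where
  "pair_opt I j k = (if j = k then 2 * opt_time I j else min (opt_time I j) (opt_time I k))"

definition job_tasks :: "nat set \<Rightarrow> nat \<Rightarrow> task set" where
  "job_tasks D j = (if j \<in> D then {Test j, Exec j} else {Untested j})"

definition last_task :: "nat set \<Rightarrow> nat \<Rightarrow> task" where
  "last_task D j = (if j \<in> D then Exec j else Untested j)"

lemma opt_time_nonneg: "valid_inst I \<Longrightarrow> j < jobs I \<Longrightarrow> 0 \<le> opt_time I j"
  by (auto simp: opt_time_def valid_inst_def)

lemma sum_task_set:
  "sum f (task_set I D) = (\<Sum>j<jobs I. sum f (job_tasks D j))"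
proof -
  have "task_set I D = (\<Union>j<jobs I. job_tasks D j)"
    unfolding task_set_def job_tasks_def by simp
  then show ?thesis
    by (simp only:) (rule sum.UNION_disjoint; auto simp: job_tasks_def split: if_splits)
qed

text \<open>Regroups by job the work done up to some moment. Both the lower bound on the optimum and
  the expression of PCP completion times through \<open>delay\<close> use this form.\<close>

lemma sum_filter_task_set:
  fixes f :: "task \<Rightarrow> real"
  shows "sum f {x \<in> task_set I D. P x}
    = (\<Sum>j<jobs I. \<Sum>x\<in>job_tasks D j. if P x then f x else 0)"
  by (simp add: sum.inter_filter[OF finite_task_set] sum_task_set)

lemma opt_time_le_sum:
  "opt_time I j \<le> sum (duration I) (job_tasks D j)"
  by (auto simp: opt_time_def job_tasks_def)

lemma completion_last_task:
  assumes "dom S = task_set I D" "j < jobs I"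
  shows "completion I S j = finish I S (last_task D j)"
  using assms by (simp add: completion_def last_task_def task_set_iff)

text \<open>Disjoint intervals inside [0, T] have total length at most \<open>T\<close>. The
  induction removes the interval that starts last and takes its start as the new bound for the
  others.\<close>

lemma sum_duration_le:
  assumes "finite X" "0 \<le> T"
    and "\<And>x. x \<in> X \<Longrightarrow> 0 \<le> start S x \<and> 0 \<le> duration I x \<and> finish I S x \<le> T"
    and "\<And>x y. x \<in> X \<Longrightarrow> y \<in> X \<Longrightarrow> x \<noteq> y \<Longrightarrow>
      finish I S x \<le> start S y \<or> finish I S y \<le> start S x"
  shows "sum (duration I) X \<le> T"
  using assms
proof (induction "card X" arbitrary: X T rule: less_induct)
  case less
  \<comment> \<open>Tasks of duration 0 contribute nothing. They are dropped because such a task may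
    share its start with a longer one; then it could be picked as the last task although the longer
    one ends after it.\<close>
  let ?Y = "{x \<in> X. 0 < duration I x}"
  have fin: "finite ?Y" using less.prems(1) by simp
  have Y: "sum (duration I) X = sum (duration I) ?Y"
    using less.prems(1,3) by (intro sum.mono_neutral_right) force+
  show ?case
  proof (cases "?Y = {}")
    case False
    define x where "x = arg_min_on (\<lambda>y. - start S y) ?Y"
    have x: "x \<in> ?Y" and max: "\<And>y. y \<in> ?Y \<Longrightarrow> start S y \<le> start S x"
      unfolding x_def using arg_min_if_finite(1)[OF fin False]
        arg_min_least[OF fin False, of _ "\<lambda>y. - start S y"] by auto
    have "card (?Y - {x}) < card X"
      using x less.prems(1) by (intro psubset_card_mono) auto
    moreover have "finish I S y \<le> start S x" if "y \<in> ?Y - {x}" for y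
    proof -
      have "start S y < finish I S x" using max[of y] that x by (auto simp: finish_def)
      then show ?thesis using less.prems(4)[of x y] that x by auto
    qed
    ultimately have "sum (duration I) (?Y - {x}) \<le> start S x"
      using x less.prems by (intro less.hyps) auto
    moreover have "sum (duration I) ?Y = duration I x + sum (duration I) (?Y - {x})"
      using x fin by (rule sum.remove[rotated])
    moreover have "start S x + duration I x \<le> T" using less.prems(3) x by (auto simp: finish_def)
    ultimately show ?thesis using Y by linarith
  qed (use Y less.prems(2) in \<open>simp only: sum.empty\<close>)
qed

text \<open>Symmetrises a double sum, so that it can be estimated by treating both directions of a
  pair of jobs together.\<close>

lemma double_sum_swap:
  fixes f :: "nat \<Rightarrow> nat \<Rightarrow> real"
  shows "2 * (\<Sum>k<n. \<Sum>j<n. f j k) = (\<Sum>k<n. \<Sum>j<n. f j k + f k j)"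
  using sum.swap[of f "{..<n}" "{..<n}"] by (simp add: sum.distrib)

theorem pair_opt_le_opt_cost:
  assumes I: "valid_inst I"
  shows "(\<Sum>k<jobs I. \<Sum>j<jobs I. pair_opt I j k) \<le> 2 * opt_cost I"
proof -
  have "(\<Sum>k<jobs I. \<Sum>j<jobs I. pair_opt I j k) / 2 \<le> cost I S" if S: "feasible I S" for S
  proof -
    obtain D where D: "dom S = task_set I D" using S unfolding feasible_def by blast
    define C where "C = completion I S"
    \<comment> \<open>The part of \<open>C k\<close> charged to \<open>j\<close>. For distinct jobs
      at least one direction is charged, so \<open>w j k + w k j\<close> is at least the smaller of
      the two times; on the diagonal both directions are charged, which gives the doubled entry of
      \<open>pair_opt\<close>.\<close>
    define w where "w j k = (if C j \<le> C k then opt_time I j else 0)" for j k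
    have fin: "finish I S x \<le> C j" if "j < jobs I" "x \<in> job_tasks D j" for j x
    proof (cases "j \<in> D")
      case True
      then have "finish I S (Test j) \<le> start S (Exec j)" "0 \<le> ptime I j"
        using S D that(1) I unfolding feasible_def valid_inst_def by (auto simp: task_set_iff)
      then show ?thesis
        using that True D
        by (auto simp: C_def completion_last_task job_tasks_def last_task_def finish_def)
    qed (use that D in \<open>auto simp: C_def completion_last_task job_tasks_def last_task_def\<close>)
    have C: "(\<Sum>j<jobs I. w j k) \<le> C k" if k: "k < jobs I" for k
    proof -
      have last: "last_task D k \<in> dom S" using k D by (simp add: last_task_def task_set_iff)
      then have "0 \<le> start S (last_task D k)" "0 \<le> duration I (last_task D k)"
        using S duration_nonneg[OF I] D unfolding feasible_def by auto
      then have C0: "0 \<le> C k" by (simp add: C_def completion_last_task[OF D k] finish_def)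
      have "(\<Sum>j<jobs I. w j k) \<le>
          (\<Sum>j<jobs I. \<Sum>x\<in>job_tasks D j. if finish I S x \<le> C k then duration I x else 0)"
      proof (rule sum_mono)
        fix j assume j: "j \<in> {..<jobs I}"
        have nonneg: "0 \<le> duration I x" if "x \<in> job_tasks D j" for x
          using that j I by (auto simp: job_tasks_def valid_inst_def split: if_splits)
        show "w j k \<le> (\<Sum>x\<in>job_tasks D j. if finish I S x \<le> C k then duration I x else 0)"
        proof (cases "C j \<le> C k")
          case True
          then have "(\<Sum>x\<in>job_tasks D j. if finish I S x \<le> C k then duration I x else 0)
              = sum (duration I) (job_tasks D j)"
            using fin[of j] j by (intro sum.cong) force+
          then show ?thesis using True opt_time_le_sum by (simp add: w_def)
        qed (use nonneg in \<open>auto simp: w_def intro!: sum_nonneg\<close>)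
      qed
      also have "\<dots> = sum (duration I) {x \<in> task_set I D. finish I S x \<le> C k}"
        by (rule sum_filter_task_set[symmetric])
      \<comment> \<open>The tasks finished by \<open>C k\<close> occupy disjoint intervals inside
        [0, C k].\<close>
      also have "\<dots> \<le> C k"
        using S D C0 duration_nonneg[OF I] unfolding feasible_def
        by (intro sum_duration_le) (auto simp: finite_task_set)
      finally show ?thesis .
    qed
    have "(\<Sum>k<jobs I. \<Sum>j<jobs I. pair_opt I j k) \<le> (\<Sum>k<jobs I. \<Sum>j<jobs I. w j k + w k j)"
      using opt_time_nonneg[OF I] by (intro sum_mono) (auto simp: pair_opt_def w_def min_def)
    also have "\<dots> = 2 * (\<Sum>k<jobs I. \<Sum>j<jobs I. w j k)" by (rule double_sum_swap[symmetric])
    also have "\<dots> \<le> 2 * cost I S"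
      unfolding cost_def C_def[symmetric] using C by (intro mult_left_mono sum_mono) auto
    finally show ?thesis by simp
  qed
  then show ?thesis using opt_cost_greatest[OF I] by fastforce
qed


section \<open>The order of the tasks in a PCP schedule\<close>

text \<open>The rank of a task is its position in the run. The premise on \<open>Test j\<close> in the last conjunct says that \<open>y\<close> is
  in the queue when \<open>x\<close> is extracted.\<close>

definition priority_rank :: "real \<Rightarrow> inst \<Rightarrow> task set \<Rightarrow> (task \<Rightarrow> nat) \<Rightarrow> bool" where
  "priority_rank \<beta> I U r \<longleftrightarrow> inj_on r U \<and>
     (\<forall>j. Exec j \<in> U \<longrightarrow> r (Test j) < r (Exec j)) \<and>
     (\<forall>x\<in>U. \<forall>y\<in>U. r x < r y \<longrightarrow> (\<forall>j. y = Exec j \<longrightarrow> r (Test j) < r x) \<longrightarrow>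
       weight \<beta> I x \<le> weight \<beta> I y)"

text \<open>All tasks that have not been run yet share the rank \<open>n\<close>, which exceeds the other ranks.\<close>

definition rank_inv :: "real \<Rightarrow> inst \<Rightarrow> task set \<Rightarrow> real \<Rightarrow> schedule \<Rightarrow> (task \<Rightarrow> nat) \<Rightarrow> nat \<Rightarrow> bool"
  where "rank_inv \<beta> I U T S r n \<longleftrightarrow>
     (\<forall>x. if x \<in> dom S then r x < n else r x = n) \<and>
     inj_on r (dom S) \<and>
     (\<forall>j. Exec j \<in> dom S \<longrightarrow> r (Test j) < r (Exec j)) \<and>
     (\<forall>x\<in>dom S. \<forall>y\<in>U. r x < r y \<longrightarrow> (\<forall>j. y = Exec j \<longrightarrow> r (Test j) < r x) \<longrightarrow>
       weight \<beta> I x \<le> weight \<beta> I y) \<and>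
     T = sum (duration I) (dom S) \<and>
     (\<forall>x\<in>dom S. finish I S x = sum (duration I) {y \<in> dom S. r y \<le> r x})"

text \<open>The extracted task keeps the common rank \<open>n\<close>, and all tasks that remain
  unrun move up to \<open>Suc n\<close>. Comparisons with the tasks run earlier are thereby
  unchanged, so only those that involve the new task need an argument.\<close>

lemma rank_inv_step:
  assumes I: "valid_inst I" and "pcp_step \<beta> I (Q, T, S) (Q', T', S')"
    and P: "pcp_inv \<alpha> I (Q, T, S)"
    and R: "rank_inv \<beta> I (task_set I (tested_jobs \<alpha> I)) T S r n"
  shows "\<exists>r. rank_inv \<beta> I (task_set I (tested_jobs \<alpha> I)) T' S' r (Suc n)"
  using assms(2)
proof cases
  case (1 x)
  let ?U = "task_set I (tested_jobs \<alpha> I)"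
  define r' where "r' y = (if y = x then n else if y \<in> dom S then r y else Suc n)" for y
  have Q: "Q = {x \<in> ?U - dom S. \<forall>j. x = Exec j \<longrightarrow> Test j \<in> dom S}" and sub: "dom S \<subseteq> ?U"
    using P unfolding pcp_inv_def by auto
  have fin: "finite (dom S)" using sub finite_task_set finite_subset by blast
  have x: "x \<in> ?U" "x \<notin> dom S" "\<And>j. x = Exec j \<Longrightarrow> Test j \<in> dom S"
    using 1(4) Q by auto
  have dom: "dom S' = insert x (dom S)" using 1(3) by simp
  have r: "\<And>y. y \<in> dom S \<Longrightarrow> r y < n" "\<And>y. y \<notin> dom S \<Longrightarrow> r y = n"
    and inj: "inj_on r (dom S)"
    and test: "\<And>j. Exec j \<in> dom S \<Longrightarrow> r (Test j) < r (Exec j)"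
    and wt: "\<And>y z. y \<in> dom S \<Longrightarrow> z \<in> ?U \<Longrightarrow> r y < r z \<Longrightarrow>
      (\<And>j. z = Exec j \<Longrightarrow> r (Test j) < r y) \<Longrightarrow> weight \<beta> I y \<le> weight \<beta> I z"
    and T: "T = sum (duration I) (dom S)"
    and fn: "\<And>y. y \<in> dom S \<Longrightarrow> finish I S y = sum (duration I) {z \<in> dom S. r z \<le> r y}"
    using R unfolding rank_inv_def by (meson, meson, blast+)
  have lt: "r' z < r' y \<longleftrightarrow> r z < r y" if "y \<in> dom S" for y z
    using that r(1)[of y] r(2)[OF x(2)] r(2)[of z] x(2) by (cases "z = x") (auto simp: r'_def)
  have "\<forall>y. if y \<in> dom S' then r' y < Suc n else r' y = Suc n"
    using r(1) unfolding dom by (auto simp: r'_def less_Suc_eq)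
  moreover have "inj_on r' (dom S')"
    unfolding dom using inj r(1) x(2) by (auto simp: inj_on_def r'_def)
  moreover have "r' (Test j) < r' (Exec j)" if "Exec j \<in> dom S'" for j
  proof (cases "x = Exec j")
    case True
    then show ?thesis using x(3)[of j] r(1)[of "Test j"] by (simp add: r'_def)
  next
    case False
    then show ?thesis using that dom test[of j] lt[of "Exec j" "Test j"] by auto
  qed
  moreover have "weight \<beta> I y \<le> weight \<beta> I z"
    if "y \<in> dom S'" "z \<in> ?U" "r' y < r' z" "\<forall>j. z = Exec j \<longrightarrow> r' (Test j) < r' y" for y z
  proof (cases "y = x")
    case True
    then have z: "z \<noteq> x" "z \<notin> dom S"
      using that(3) r(1)[of z] by (auto simp: r'_def split: if_splits)
    \<comment> \<open>Ranks below \<open>n\<close> belong only to tasks already run, so the premise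
      forces the test to be one of them. Hence \<open>z\<close> was in the queue when
      \<open>x\<close> was extracted.\<close>
    have "Test j \<in> dom S" if "z = Exec j" for j
      using that \<open>\<forall>j. z = Exec j \<longrightarrow> r' (Test j) < r' y\<close> True
      by (auto simp: r'_def split: if_splits)
    then have "z \<in> Q" using z that(2) Q by blast
    then show ?thesis using 1(5) True by blast
  next
    case False
    then have y: "y \<in> dom S" using that(1) dom by simp
    have "r y < r z" using that(3) y False r(1)[of y] r(2)[OF x(2)] r(2)[of z]
      by (cases "z = x") (auto simp: r'_def split: if_splits)
    moreover have "r (Test j) < r y" if "z = Exec j" for j
      using that \<open>\<forall>j. z = Exec j \<longrightarrow> r' (Test j) < r' y\<close> lt[OF y] by blast
    ultimately show ?thesis using wt y that(2) by blast
  qed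
  moreover have "T' = sum (duration I) (dom S')"
    using 1(2) T x(2) fin unfolding dom by simp
  moreover have "finish I S' y = sum (duration I) {z \<in> dom S'. r' z \<le> r' y}" if "y \<in> dom S'" for y
  proof (cases "y = x")
    case True
    have "{z \<in> dom S'. r' z \<le> r' y} = dom S'"
      using r(1) True unfolding dom by (auto simp: r'_def intro: less_imp_le)
    then show ?thesis
      using True 1(3) T x(2) fin unfolding dom by (simp add: finish_def start_def)
  next
    case False
    then have y: "y \<in> dom S" using that dom by simp
    have "{z \<in> dom S'. r' z \<le> r' y} = {z \<in> dom S. r z \<le> r y}"
      using y x(2) r(1)[OF y] unfolding dom by (auto simp: r'_def split: if_splits)
    then show ?thesis
      using False 1(3) fn[OF y] by (simp add: finish_def start_def)
  qed
  ultimately show ?thesis unfolding rank_inv_def by blast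
qed

text \<open>Replaces the inductive run by a linear order of the tasks. As PCP never idles, a task
  finishes at the total duration of the tasks up to it in this order; the pair estimates use only
  the order and the weight comparisons.\<close>

theorem pcp_priority_rank:
  assumes I: "valid_inst I" and "S \<in> pcp \<alpha> \<beta> I"
  defines "U \<equiv> task_set I (tested_jobs \<alpha> I)"
  obtains r where "dom S = U" "priority_rank \<beta> I U r"
    "\<And>x. x \<in> U \<Longrightarrow> finish I S x = sum (duration I) {y \<in> U. r y \<le> r x}"
proof -
  obtain T where T: "(pcp_step \<beta> I)\<^sup>*\<^sup>* (pcp_init \<alpha> I, 0, Map.empty) ({}, T, S)"
    using assms(2) unfolding pcp_def by blast
  have steps: "pcp_inv \<alpha> I s \<and> (\<exists>r n. rank_inv \<beta> I U (fst (snd s)) (snd (snd s)) r n)"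
    if "(pcp_step \<beta> I)\<^sup>*\<^sup>* (pcp_init \<alpha> I, 0, Map.empty) s" for s
    using that
  proof induction
    case base
    \<comment> \<open>Nothing has been run yet, so all tasks share the rank \<open>n\<close> =
      0.\<close>
    show ?case using pcp_inv_init by (auto simp: rank_inv_def intro: exI[of _ "\<lambda>_. 0"])
  next
    case (step s s')
    obtain Q T S where s: "s = (Q, T, S)" by (cases s)
    obtain Q' T' S' where s': "s' = (Q', T', S')" by (cases s')
    show ?case
      using step.IH pcp_inv_step[OF I step(2)] rank_inv_step[OF I step(2)[unfolded s s']]
      unfolding s s' U_def fst_conv snd_conv by blast
  qed
  have dom: "dom S = U" unfolding U_def using pcp_inv_final steps[OF T] by blast
  obtain r n where "rank_inv \<beta> I U T S r n" using steps[OF T] by auto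
  then show thesis using that[of r] dom unfolding rank_inv_def priority_rank_def by auto
qed


section \<open>Charging pairs of jobs\<close>

text \<open>The share of \<open>j\<close> in the completion time of \<open>k\<close>: summed over
  all \<open>j\<close> it gives exactly the completion time of \<open>k\<close> in a PCP
  schedule.\<close>

definition delay :: "inst \<Rightarrow> nat set \<Rightarrow> (task \<Rightarrow> nat) \<Rightarrow> nat \<Rightarrow> nat \<Rightarrow> real" where
  "delay I D r j k =
     (\<Sum>x\<in>job_tasks D j. if r x \<le> r (last_task D k) then duration I x else 0)"

text \<open>Serves the orders in which a test of length \<open>t\<close> is run before a task of
  weight \<open>x\<close>: the priority rule makes \<open>t\<close> at most
  \<open>x / \<beta>\<close>. The factor \<open>c\<close> is later \<alpha> or 1 + 1 /
  \<alpha>.\<close>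

lemma add_le_of_weight_le:
  fixes \<beta> \<rho> c q t x :: real
  assumes "\<beta> * t \<le> x" "x \<le> c * q" "c * (1 + 1 / \<beta>) \<le> \<rho>" "0 < \<beta>" "0 \<le> q"
  shows "t + x \<le> \<rho> * q"
proof -
  have "t \<le> x / \<beta>" using assms(1,4) by (simp add: field_simps)
  then have "t + x \<le> (1 + 1 / \<beta>) * x" by (simp add: algebra_simps)
  also have "\<dots> \<le> (1 + 1 / \<beta>) * (c * q)" using assms(2,4) by (intro mult_left_mono) auto
  also have "\<dots> = c * (1 + 1 / \<beta>) * q" by simp
  also have "\<dots> \<le> \<rho> * q" using assms(3,5) by (rule mult_right_mono)
  finally show ?thesis .
qed

text \<open>Taking \<rho> as any common upper bound of the five expressions keeps \<open>Max\<close>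
  out of the estimates. The second expression appears in factored form.\<close>

locale pcp_params =
  fixes \<alpha> \<beta> \<rho> :: real
  assumes \<alpha>: "1 \<le> \<alpha>" and \<beta>: "1 \<le> \<beta>"
    and \<rho>: "\<alpha> * (1 + 1 / \<beta>) \<le> \<rho>" "(1 + 1 / \<alpha>) * (1 + 1 / \<beta>) \<le> \<rho>" "\<beta> \<le> \<rho>" "2 \<le> \<rho>"
      "1 + 2 / \<alpha> \<le> \<rho>"
begin

section \<open>Bounds for a single job in terms of its offline time\<close>

lemma le_ratio: "\<alpha> \<le> \<rho>" "1 + 1 / \<alpha> \<le> \<rho>"
proof -
  have "\<alpha> * 1 \<le> \<alpha> * (1 + 1 / \<beta>)" using \<alpha> \<beta> by (intro mult_left_mono) auto
  then show "\<alpha> \<le> \<rho>" using \<rho>(1) by simp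
  have "1 / \<alpha> \<le> 2 / \<alpha>" using \<alpha> by (simp add: divide_right_mono)
  then show "1 + 1 / \<alpha> \<le> \<rho>" using \<rho>(5) by linarith
qed

text \<open>The decision to test gives \<open>t\<^sub>j \<le> u\<^sub>j / \<alpha>\<close>. If the
  offline time is \<open>u\<^sub>j\<close>, this is combined with
  \<open>p\<^sub>j \<le> u\<^sub>j\<close>; otherwise it is \<open>t\<^sub>j + p\<^sub>j\<close>
  itself. In the last bound these two cases produce the expressions 1 + 2 / \<alpha> and 2.\<close>

lemma tested_bounds:
  assumes "valid_inst I" "j < jobs I" "j \<in> tested_jobs \<alpha> I"
  shows "ttime I j \<le> opt_time I j"
    "ttime I j + ptime I j \<le> (1 + 1 / \<alpha>) * opt_time I j"
    "ttime I j + ptime I j \<le> \<rho> * opt_time I j"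
    "ttime I j + (ttime I j + ptime I j) \<le> \<rho> * opt_time I j"
proof -
  let ?t = "ttime I j" and ?p = "ptime I j" and ?u = "upper I j" and ?q = "opt_time I j"
  have v: "0 \<le> ?t" "0 \<le> ?p" "?p \<le> ?u" "\<alpha> * ?t \<le> ?u" "0 \<le> ?u"
    using assms by (auto simp: valid_inst_def tested_jobs_def)
  have t: "?t \<le> ?u / \<alpha>" using v(4) \<alpha> by (simp add: field_simps)
  have "1 * ?t \<le> \<alpha> * ?t" using \<alpha> v by (intro mult_right_mono) auto
  then show "?t \<le> ?q" using v by (simp add: opt_time_def)
  have q0: "0 \<le> ?q" using assms by (intro opt_time_nonneg)
  show le: "?t + ?p \<le> (1 + 1 / \<alpha>) * ?q"
  proof (cases "?u \<le> ?t + ?p")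
    case True
    then show ?thesis using t v by (simp add: opt_time_def algebra_simps)
  next
    case False
    then show ?thesis using \<alpha> v by (simp add: opt_time_def algebra_simps)
  qed
  show "?t + ?p \<le> \<rho> * ?q"
    using le mult_right_mono[OF le_ratio(2) q0] by linarith
  show "?t + (?t + ?p) \<le> \<rho> * ?q"
  proof (cases "?u \<le> ?t + ?p")
    case True
    then have "?t + (?t + ?p) \<le> (1 + 2 / \<alpha>) * ?q"
      using t v by (simp add: opt_time_def distrib_right)
    then show ?thesis using mult_right_mono[OF \<rho>(5) q0] by linarith
  next
    case False
    then have "?t + (?t + ?p) \<le> 2 * ?q" using v by (simp add: opt_time_def)
    then show ?thesis using mult_right_mono[OF \<rho>(4) q0] by linarith
  qed
qed

text \<open>Skipping the test means \<open>u\<^sub>j < \<alpha> * t\<^sub>j\<close>, so even testing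
  offline saves at most a factor \<alpha>.\<close>

lemma untested_bounds:
  assumes "valid_inst I" "j < jobs I" "j \<notin> tested_jobs \<alpha> I"
  shows "upper I j \<le> \<alpha> * opt_time I j" "upper I j \<le> \<rho> * opt_time I j"
proof -
  have v: "0 \<le> ttime I j" "0 \<le> ptime I j" "0 \<le> upper I j" "upper I j < \<alpha> * ttime I j"
    using assms by (auto simp: valid_inst_def tested_jobs_def)
  have "1 * upper I j \<le> \<alpha> * upper I j" using \<alpha> v by (intro mult_right_mono) auto
  moreover have "0 \<le> \<alpha> * ptime I j" using \<alpha> v by auto
  ultimately show le: "upper I j \<le> \<alpha> * opt_time I j"
    using v by (auto simp: opt_time_def min_def distrib_left)
  show "upper I j \<le> \<rho> * opt_time I j"
    using le mult_right_mono[OF le_ratio(1) opt_time_nonneg[OF assms(1,2)]] by linarith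
qed

section \<open>Mutual delay of two jobs under a fixed order of the tasks\<close>

context
  fixes I :: inst and r :: "task \<Rightarrow> nat"
  assumes I: "valid_inst I"
    and rank: "priority_rank \<beta> I (task_set I (tested_jobs \<alpha> I)) r"
begin

abbreviation "D \<equiv> tested_jobs \<alpha> I"

lemma rank_facts:
  shows rank_neq: "\<And>x y. x \<in> task_set I D \<Longrightarrow> y \<in> task_set I D \<Longrightarrow> x \<noteq> y \<Longrightarrow> r x \<noteq> r y"
    and rank_Test: "\<And>j. Exec j \<in> task_set I D \<Longrightarrow> r (Test j) < r (Exec j)"
    and rank_weight: "\<And>x y. x \<in> task_set I D \<Longrightarrow> y \<in> task_set I D \<Longrightarrow> r x < r y \<Longrightarrow>
       (\<And>j. y = Exec j \<Longrightarrow> r (Test j) < r x) \<Longrightarrow> weight \<beta> I x \<le> weight \<beta> I y"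
  using rank unfolding priority_rank_def inj_on_def by blast+

lemma delay_self:
  assumes j: "j < jobs I"
  shows "delay I D r j j \<le> \<rho> * opt_time I j"
proof (cases "j \<in> D")
  case True
  then show ?thesis
    using tested_bounds(3)[OF I j] rank_Test[of j] j
    by (simp add: delay_def job_tasks_def last_task_def task_set_iff)
next
  case False
  then show ?thesis
    using untested_bounds(2)[OF I j] by (simp add: delay_def job_tasks_def last_task_def)
qed

text \<open>Only the job run first causes a delay, and by priority its upper limit is the smaller
  one.\<close>

lemma delay_untested_untested:
  assumes j: "j < jobs I" "j \<notin> D" and k: "k < jobs I" "k \<notin> D" and "r (Untested j) < r (Untested k)"
  shows "delay I D r j k + delay I D r k j \<le> \<rho> * min (opt_time I j) (opt_time I k)"
proof -
  have "delay I D r j k + delay I D r k j = upper I j"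
    using assms by (simp add: delay_def job_tasks_def last_task_def)
  moreover have "upper I j \<le> upper I k"
    using rank_weight[of "Untested j" "Untested k"] assms by (simp add: task_set_iff)
  ultimately show ?thesis
    using untested_bounds(2)[OF I j] untested_bounds(2)[OF I k] by (auto simp: min_def)
qed

text \<open>The three cases are the positions of the untested job before, between and after the two
  tasks of \<open>k\<close>. In each, the total delay is bounded separately by the offline times of
  \<open>j\<close> and of \<open>k\<close>.\<close>

lemma delay_untested_tested:
  assumes j: "j < jobs I" "j \<notin> D" and k: "k < jobs I" "k \<in> D"
  shows "delay I D r j k + delay I D r k j \<le> \<rho> * min (opt_time I j) (opt_time I k)"
proof -
  have U: "Untested j \<in> task_set I D" "Test k \<in> task_set I D" "Exec k \<in> task_set I D"
    using assms by (simp_all add: task_set_iff)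
  note q = opt_time_nonneg[OF I j(1)] opt_time_nonneg[OF I k(1)]
  have neq: "r (Untested j) \<noteq> r (Test k)" "r (Untested j) \<noteq> r (Exec k)"
    using rank_neq U by blast+
  note TE = rank_Test[OF U(3)]
  consider "r (Untested j) < r (Test k)" | "r (Test k) < r (Untested j)" "r (Untested j) < r (Exec k)"
    | "r (Exec k) < r (Untested j)" using neq by linarith
  then show ?thesis
  proof cases
    case 1
    then have "delay I D r j k + delay I D r k j = upper I j"
      using assms TE by (simp add: delay_def job_tasks_def last_task_def)
    moreover have "upper I j \<le> \<beta> * ttime I k"
      using rank_weight[OF U(1,2) 1] by simp
    moreover have "\<beta> * ttime I k \<le> \<beta> * opt_time I k" "\<beta> * opt_time I k \<le> \<rho> * opt_time I k"
      using tested_bounds(1)[OF I k] \<beta> \<rho>(3) q by (auto intro: mult_left_mono mult_right_mono)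
    ultimately show ?thesis using untested_bounds(2)[OF I j] by (auto simp: min_def)
  next
    \<comment> \<open>The test of \<open>k\<close> delays \<open>j\<close>, and all of
      \<open>j\<close> delays \<open>k\<close>. As \<open>Exec k\<close> is already queued, the
      weight of \<open>j\<close> lies between those of \<open>Test k\<close> and
      \<open>Exec k\<close>; the upper comparison links it to the offline time of
      \<open>k\<close>.\<close>
    case 2
    then have "delay I D r j k + delay I D r k j = ttime I k + upper I j"
      using assms TE by (simp add: delay_def job_tasks_def last_task_def)
    moreover have w: "\<beta> * ttime I k \<le> upper I j" "upper I j \<le> ttime I k + ptime I k"
      using rank_weight[OF U(2,1)] rank_weight[OF U(1,3)] 2 by auto
    moreover have "upper I j \<le> (1 + 1 / \<alpha>) * opt_time I k"
      using w(2) tested_bounds(2)[OF I k] by linarith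
    then have "ttime I k + upper I j \<le> \<rho> * opt_time I k"
      using \<beta> q \<rho>(2) by (intro add_le_of_weight_le[OF w(1)]) auto
    moreover have "ttime I k + upper I j \<le> \<rho> * opt_time I j"
      using \<beta> q \<rho>(1) untested_bounds(1)[OF I j] by (intro add_le_of_weight_le[OF w(1)]) auto
    ultimately show ?thesis by (auto simp: min_def)
  next
    case 3
    then have "delay I D r j k + delay I D r k j = ttime I k + ptime I k"
      using assms TE by (simp add: delay_def job_tasks_def last_task_def)
    moreover have "ttime I k + ptime I k \<le> upper I j"
      using rank_weight[OF U(3,1) 3] by simp
    ultimately show ?thesis
      using untested_bounds(2)[OF I j] tested_bounds(3)[OF I k] by (auto simp: min_def)
  qed
qed

text \<open>With the test of \<open>j\<close> first, priority gives
  \<open>t\<^sub>j \<le> t\<^sub>k\<close>. The cases are: \<open>j\<close> is finished before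
  \<open>k\<close> is tested; both tests come first and then \<open>j\<close>; both tests come first
  and then \<open>k\<close>.\<close>

lemma delay_tested_tested:
  assumes j: "j < jobs I" "j \<in> D" and k: "k < jobs I" "k \<in> D"
    and jk: "r (Test j) < r (Test k)"
  shows "delay I D r j k + delay I D r k j \<le> \<rho> * min (opt_time I j) (opt_time I k)"
proof -
  have U: "Test j \<in> task_set I D" "Exec j \<in> task_set I D" "Test k \<in> task_set I D"
    "Exec k \<in> task_set I D"
    using assms by (simp_all add: task_set_iff)
  have "j \<noteq> k" using jk by auto
  then have neq: "r (Exec j) \<noteq> r (Test k)" "r (Exec j) \<noteq> r (Exec k)"
    using rank_neq U by blast+
  note q = opt_time_nonneg[OF I j(1)] opt_time_nonneg[OF I k(1)]
  note TE = rank_Test[OF U(2)] rank_Test[OF U(4)]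
  have "\<beta> * ttime I j \<le> \<beta> * ttime I k" using rank_weight[OF U(1,3) jk] by simp
  then have t: "ttime I j \<le> ttime I k" using \<beta> by simp
  consider "r (Exec j) < r (Test k)" | "r (Test k) < r (Exec j)" "r (Exec j) < r (Exec k)"
    | "r (Exec k) < r (Exec j)" using neq by linarith
  then show ?thesis
  proof cases
    case 1
    then have "delay I D r j k + delay I D r k j = ttime I j + ptime I j"
      using assms TE by (simp add: delay_def job_tasks_def last_task_def)
    moreover have "ttime I j + ptime I j \<le> \<beta> * ttime I k"
      using rank_weight[OF U(2,3) 1] by simp
    moreover have "\<beta> * ttime I k \<le> \<beta> * opt_time I k" "\<beta> * opt_time I k \<le> \<rho> * opt_time I k"
      using tested_bounds(1)[OF I k] \<beta> \<rho>(3) q by (auto intro: mult_left_mono mult_right_mono)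
    ultimately show ?thesis using tested_bounds(3)[OF I j] by (auto simp: min_def)
  next
    case 2
    let ?x = "ttime I j + ptime I j"
    have "delay I D r j k + delay I D r k j = ttime I k + ?x"
      using assms TE 2 by (simp add: delay_def job_tasks_def last_task_def)
    moreover have w: "\<beta> * ttime I k \<le> ?x" "?x \<le> ttime I k + ptime I k"
      using rank_weight[OF U(3,2)] rank_weight[OF U(2,4)] 2 jk by auto
    moreover have "?x \<le> (1 + 1 / \<alpha>) * opt_time I k"
      using w(2) tested_bounds(2)[OF I k] by linarith
    then have "ttime I k + ?x \<le> \<rho> * opt_time I k"
      using \<beta> q \<rho>(2) by (intro add_le_of_weight_le[OF w(1)]) auto
    moreover have "ttime I k + ?x \<le> \<rho> * opt_time I j"
      using \<beta> q \<rho>(2) tested_bounds(2)[OF I j] by (intro add_le_of_weight_le[OF w(1)]) auto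
    ultimately show ?thesis by (auto simp: min_def)
  next
    \<comment> \<open>Both tests and the execution of \<open>k\<close> count here. Replacing
      \<open>t\<^sub>j\<close> by \<open>t\<^sub>k\<close>, or \<open>t\<^sub>k + p\<^sub>k\<close>
      by \<open>t\<^sub>j + p\<^sub>j\<close>, leaves one job whose test is counted twice, as in the
      last part of \<open>tested_bounds\<close>.\<close>
    case 3
    have "delay I D r j k + delay I D r k j = ttime I j + (ttime I k + ptime I k)"
      using assms TE 3 by (simp add: delay_def job_tasks_def last_task_def)
    moreover have "ttime I k + ptime I k \<le> ttime I j + ptime I j"
      using rank_weight[OF U(4,2) 3] jk TE by simp
    ultimately show ?thesis
      using t tested_bounds(4)[OF I j] tested_bounds(4)[OF I k] by (auto simp: min_def)
  qed
qed

lemma delay_pair: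
  assumes j: "j < jobs I" and k: "k < jobs I"
  shows "delay I D r j k + delay I D r k j \<le> \<rho> * pair_opt I j k"
proof (cases "j = k")
  case True
  then show ?thesis using delay_self[OF j] by (simp add: pair_opt_def)
next
  case False
  have *: "x \<in> task_set I D \<Longrightarrow> y \<in> task_set I D \<Longrightarrow> x \<noteq> y \<Longrightarrow> r x < r y \<or> r y < r x" for x y
    using rank_neq by (meson nat_neq_iff)
  have "delay I D r j k + delay I D r k j \<le> \<rho> * min (opt_time I j) (opt_time I k)"
  proof (cases "j \<in> D"; cases "k \<in> D")
    assume "j \<in> D" "k \<in> D"
    then show ?thesis
      using delay_tested_tested[of j k] delay_tested_tested[of k j] *[of "Test j" "Test k"] j k False
      by (auto simp: task_set_iff add.commute min.commute)
  next
    assume "j \<in> D" "k \<notin> D"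
    then show ?thesis
      using delay_untested_tested[of k j] j k by (simp add: add.commute min.commute)
  next
    assume "j \<notin> D" "k \<in> D"
    then show ?thesis using delay_untested_tested[of j k] j k by simp
  next
    assume "j \<notin> D" "k \<notin> D"
    then show ?thesis
      using delay_untested_untested[of j k] delay_untested_untested[of k j]
        *[of "Untested j" "Untested k"] j k False
      by (auto simp: task_set_iff add.commute min.commute)
  qed
  then show ?thesis using False by (simp add: pair_opt_def)
qed

end

text \<open>Twice the PCP cost is the sum of the mutual delays over ordered pairs; these are
  compared termwise with \<open>pair_opt\<close>, whose sum is at most twice the optimum.\<close>

theorem pcp_competitive: "competitive (pcp \<alpha> \<beta>) \<rho>"
  unfolding competitive_def
proof (intro allI impI ballI)
  fix I S assume I: "valid_inst I" and "S \<in> pcp \<alpha> \<beta> I"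
  then obtain r where dom: "dom S = task_set I (tested_jobs \<alpha> I)"
    and rank: "priority_rank \<beta> I (task_set I (tested_jobs \<alpha> I)) r"
    and fin: "\<And>x. x \<in> task_set I (tested_jobs \<alpha> I) \<Longrightarrow>
      finish I S x = sum (duration I) {y \<in> task_set I (tested_jobs \<alpha> I). r y \<le> r x}"
    by (rule pcp_priority_rank) (rule that; simp)
  let ?d = "delay I (tested_jobs \<alpha> I) r"
  have "completion I S k = (\<Sum>j<jobs I. ?d j k)" if k: "k < jobs I" for k
  proof -
    have "last_task (tested_jobs \<alpha> I) k \<in> task_set I (tested_jobs \<alpha> I)"
      using k by (simp add: last_task_def task_set_iff)
    then show ?thesis
      by (simp add: completion_last_task[OF dom k] fin sum_filter_task_set delay_def)
  qed
  then have "2 * cost I S = 2 * (\<Sum>k<jobs I. \<Sum>j<jobs I. ?d j k)" by (simp add: cost_def)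
  also have "\<dots> = (\<Sum>k<jobs I. \<Sum>j<jobs I. ?d j k + ?d k j)" by (rule double_sum_swap)
  also have "\<dots> \<le> (\<Sum>k<jobs I. \<Sum>j<jobs I. \<rho> * pair_opt I j k)"
    using delay_pair[OF I rank] by (intro sum_mono) auto
  also have "\<dots> = \<rho> * (\<Sum>k<jobs I. \<Sum>j<jobs I. pair_opt I j k)" by (simp add: sum_distrib_left)
  also have "\<dots> \<le> \<rho> * (2 * opt_cost I)"
    using pair_opt_le_opt_cost[OF I] \<rho>(4) by (intro mult_left_mono) auto
  finally show "cost I S \<le> \<rho> * opt_cost I" by simp
qed

end


section \<open>The choice of the parameters\<close>

lemma golden_ratio_bounds:
  assumes "\<phi> = (1 + sqrt 5) / 2"
  shows "\<phi>\<^sup>2 = \<phi> + 1" "1.61803 \<le> \<phi>" "\<phi> \<le> 1.618034"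
proof -
  show "\<phi>\<^sup>2 = \<phi> + 1" unfolding assms by (simp add: power2_eq_square field_simps)
  have "2.23606 \<le> sqrt 5" by (rule real_le_rsqrt) (simp add: power2_eq_square)
  then show "1.61803 \<le> \<phi>" unfolding assms by simp
  have "sqrt 5 \<le> 2.236068" by (rule real_le_lsqrt) (simp_all add: power2_eq_square)
  then show "\<phi> \<le> 1.618034" unfolding assms by simp
qed

theorem corollary8:
  fixes \<phi> \<beta>\<^sub>0 :: real
  assumes "\<phi> = (1 + sqrt 5) / 2"
    and "\<beta>\<^sub>0 = (\<phi> + sqrt (5 * \<phi> + 1)) / 2"
  shows "competitive_ratio (pcp \<phi> \<beta>\<^sub>0) \<le> ereal ((\<phi> + sqrt (5 * \<phi> + 1)) / 2)
    \<and> (\<phi> + sqrt (5 * \<phi> + 1)) / 2 \<le> 2.316513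
    \<and> is_arg_min
        (\<lambda>(\<alpha>, \<beta>). Max {\<alpha> * (1 + 1 / \<beta>), 1 + 1 / \<alpha> + 1 / \<beta> + 1 / (\<alpha> * \<beta>), \<beta>, 2, 1 + 2 / \<alpha>})
        (\<lambda>(\<alpha>, \<beta>). 1 \<le> \<alpha> \<and> 1 \<le> \<beta>) (\<phi>, \<beta>\<^sub>0)"
proof -
  note \<phi> = golden_ratio_bounds[OF assms(1)]
  have inv: "1 + 1 / \<phi> = \<phi>" using \<phi>(1,2) by (simp add: field_simps power2_eq_square)
  \<comment> \<open>The constant is chosen so that its mean with the upper bound 1.618034 of \<phi>
    is exactly 2.316513.\<close>
  have "sqrt (5 * \<phi> + 1) \<le> 3.014992"
    using \<phi>(3) by (intro real_le_lsqrt) (simp_all add: power2_eq_square)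
  then have upper: "\<beta>\<^sub>0 \<le> 2.316513" unfolding assms(2) using \<phi>(3) by simp
  have "3 \<le> sqrt (5 * \<phi> + 1)" using \<phi>(2) by (intro real_le_rsqrt) simp
  then have lower: "2.3 \<le> \<beta>\<^sub>0" unfolding assms(2) using \<phi>(2) by simp
  \<comment> \<open>The completed square of the quadratic equation for
    \<open>\<beta>\<^sub>0\<close> that follows; the conversion uses
    \<open>\<phi>\<^sup>2 = \<phi> + 1\<close>.\<close>
  have "(2 * \<beta>\<^sub>0 - \<phi>)\<^sup>2 = 5 * \<phi> + 1" using \<phi>(2) by (simp add: assms(2) add_divide_distrib)
  then have "\<beta>\<^sub>0 * \<beta>\<^sub>0 = \<phi> * (\<beta>\<^sub>0 + 1)"
    using \<phi>(1) by (simp add: power2_eq_square algebra_simps)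
  then have fix\<beta>: "\<phi> * (1 + 1 / \<beta>\<^sub>0) = \<beta>\<^sub>0" using lower by (simp add: field_simps)
  \<comment> \<open>By \<open>inv\<close> the left side equals \<open>2 * \<phi> - 1\<close>, which
    is below 2.3.\<close>
  have small: "1 + 2 / \<phi> \<le> \<beta>\<^sub>0" using inv lower \<phi>(3) by (simp add: field_simps)
  interpret pcp_params \<phi> \<beta>\<^sub>0 \<beta>\<^sub>0
    by unfold_locales (use \<phi>(2) lower small fix\<beta> inv in auto)
  have factor: "1 + 1 / \<alpha> + 1 / \<beta> + 1 / (\<alpha> * \<beta>) = (1 + 1 / \<alpha>) * (1 + 1 / \<beta>)" for \<alpha> \<beta> :: real
    by (simp add: algebra_simps)
  define f :: "real \<Rightarrow> real \<Rightarrow> real" where "f \<alpha> \<beta> =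
    Max {\<alpha> * (1 + 1 / \<beta>), 1 + 1 / \<alpha> + 1 / \<beta> + 1 / (\<alpha> * \<beta>), \<beta>, 2, 1 + 2 / \<alpha>}" for \<alpha> \<beta>
  have max: "\<alpha> * (1 + 1 / \<beta>) \<le> f \<alpha> \<beta>" "(1 + 1 / \<alpha>) * (1 + 1 / \<beta>) \<le> f \<alpha> \<beta>"
    "\<beta> \<le> f \<alpha> \<beta>" for \<alpha> \<beta>
    unfolding f_def factor by (rule Max_ge; simp)+
  have "f \<phi> \<beta>\<^sub>0 = \<beta>\<^sub>0"
    unfolding f_def factor unfolding inv fix\<beta> using lower small by (simp add: max_def)
  \<comment> \<open>For \<beta> at least \<open>\<beta>\<^sub>0\<close> the third expression
    suffices. For smaller \<beta> the factor 1 + 1 / \<beta> exceeds its value at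
    \<open>\<beta>\<^sub>0\<close>, while the larger of \<alpha> and 1 + 1 / \<alpha> is at least
    \<phi>: the first increases, the second decreases, and they meet at \<phi>.\<close>
  moreover have "\<beta>\<^sub>0 \<le> f \<alpha> \<beta>" if "1 \<le> \<alpha>" "1 \<le> \<beta>" for \<alpha> \<beta>
  proof (cases "\<beta>\<^sub>0 \<le> \<beta>")
    case False
    have "\<phi> \<le> \<alpha> \<or> \<phi> \<le> 1 + 1 / \<alpha>"
      using that(1) \<phi>(2) inv frac_le[of 1 1 \<alpha> \<phi>] by linarith
    then have "\<phi> * (1 + 1 / \<beta>) \<le> \<alpha> * (1 + 1 / \<beta>) \<or> \<phi> * (1 + 1 / \<beta>) \<le> (1 + 1 / \<alpha>) * (1 + 1 / \<beta>)"
      using that(2) by (auto intro: mult_right_mono)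
    moreover have "\<phi> * (1 + 1 / \<beta>\<^sub>0) \<le> \<phi> * (1 + 1 / \<beta>)"
      using False that(2) \<phi>(2) by (intro mult_left_mono) (auto intro: frac_le)
    ultimately have "\<beta>\<^sub>0 \<le> \<alpha> * (1 + 1 / \<beta>) \<or> \<beta>\<^sub>0 \<le> (1 + 1 / \<alpha>) * (1 + 1 / \<beta>)"
      using fix\<beta> by linarith
    then show ?thesis using max(1,2)[of \<alpha> \<beta>] by linarith
  qed (use max(3)[of \<beta> \<alpha>] in linarith)
  ultimately have "is_arg_min (\<lambda>(\<alpha>, \<beta>). f \<alpha> \<beta>) (\<lambda>(\<alpha>, \<beta>). 1 \<le> \<alpha> \<and> 1 \<le> \<beta>) (\<phi>, \<beta>\<^sub>0)"
    unfolding is_arg_min_linorder using \<phi>(2) lower by auto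
  moreover have "competitive_ratio (pcp \<phi> \<beta>\<^sub>0) \<le> ereal \<beta>\<^sub>0"
    using pcp_competitive by (simp add: competitive_ratio_le_iff)
  ultimately show ?thesis using upper unfolding assms(2)[symmetric] f_def by blast
qed

end
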